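(* Let $X$ be a nonempty set and let $\theta\in\mathscr{T}_X$. Define $\Delta_\theta:\mathscr{P}_\theta\to N^*\Pi_\theta$ on objects $A\in v\mathscr{P}_\theta$ and morphisms $f:A\to B$ of $\mathscr{P}_\theta$ by $$\Delta_\theta(A)=A\theta\quad\text{and}\quad \Delta_\theta(f)=(\theta_{|A})^{-1}f\,\theta:A\theta\to B\theta .$$ Then $\Delta_\theta$ is a functor and is a cross-connection between the categories $\mathscr{P}_\theta$ and $\Pi_\theta$.
   Context: Functions are written on the right and composed from left to right. $\mathscr{T}_X$ is the semigroup of all maps $X\to X$. For $a\in\mathscr{T}_X$, $\mathrm{Im}\,a$ is its image, $\mathrm{rank}\,a=|\mathrm{Im}\,a|$, and $\pi_a$ is the partition of $X$ into the nonempty fibres of $a$. A subset $A\subseteq X$ saturates a partition $\pi$ of $X$ if each $\pi$-class contains at least one element of $A$; $\pi$ separates $A$ if each $\pi$-class contains at most one element of $A$; $A$ is a cross-section of $\pi$ if each $\pi$-class contains exactly one element of $A$. $v\mathcal{C}$ denotes the set of objects of a category $\mathcal{C}$. $\mathscr{P}(X)$ is the category whose objects are the nonempty subsets of $X$ and whose morphisms $A\to B$ are all maps $A\to B$; its objects are ordered by inclusion, and the inclusion morphisms are the inclusion maps. $\mathscr{P}_\theta$ is the full subcategory of $\mathscr{P}(X)$ with $v\mathscr{P}_\theta=\{A:\pi_\theta\text{ separates }A\}$. For $A\in v\mathscr{P}_\theta$ the restriction $\theta_{|A}:A\to A\theta$ is a bijection, with inverse $(\theta_{|A})^{-1}:A\theta\to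 A$. For a partition $\pi$ of $X$, $\bar\pi$ denotes the set of all maps from $\pi$ to $X$. $\Pi_\theta$ is the category with $v\Pi_\theta=\{\bar\pi:\mathrm{Im}\,\theta\text{ saturates }\pi\}$, where a morphism $\eta^*:\bar\pi_1\to\bar\pi_2$ is given by a map $\eta:\pi_2\to\pi_1$ via $\alpha\mapsto\eta\alpha$ for $\alpha\in\bar\pi_1$. The normal dual $N^*\Pi_\theta$ is identified with the full subcategory of $\mathscr{P}(X)$ with objects $\{A:|A|\le\mathrm{rank}\,\theta\}$. Under this identification, the $M$-set in $\Pi_\theta$ of an object $B$ of $N^*\Pi_\theta$ is $MB=\{\bar\pi\in v\Pi_\theta:B\text{ is a cross-section of }\pi\}$. The ideal $\langle A\rangle$ generated by an object $A$ in one of these categories of subsets is the full subcategory whose objects are the objects contained in $A$. A functor $\Delta:\mathscr{P}_\theta\to N^*\Pi_\theta$ is a local isomorphism if it is inclusion preserving (it sends inclusion morphisms to inclusion morphisms), fully faithful, and for each $A\in v\mathscr{P}_\theta$ its restriction to $\langle A\rangle$ is an isomorphism of $\langle A\rangle$ onto $\langle\Delta(A)\rangle$. It is a cross-connection between $\mathscr{P}_\theta$ and $\Pi_\theta$ if it is a local isomorphism and for every $\bar\pi\in v\Pi_\theta$ there is some $A\in v\mathscr{P}_\theta$ with $\bar\pi\in M\Delta(A)$. *)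

theory Defs
  imports "HOL-Library.FuncSet" "HOL-Library.Disjoint_Sets"
begin

unbundle cardinal_syntax

text \<open>Functions are written on the right in the mathematics, so composition in a category
  is in diagrammatic order: \<open>cmp C f g\<close> is \<open>f\<close> followed by \<open>g\<close>, and in
  HOL notation the image \<open>A\<theta>\<close> is \<open>\<theta> ` A\<close>.\<close>

section \<open>Categories and functors\<close>

record ('o, 'm) cat =
  obj :: "'o set"
  arr :: "'m set"
  src :: "'m \<Rightarrow> 'o"
  trg :: "'m \<Rightarrow> 'o"
  idt :: "'o \<Rightarrow> 'm"
  cmp :: "'m \<Rightarrow> 'm \<Rightarrow> 'm"

definition hom :: "('o, 'm) cat \<Rightarrow> 'o \<Rightarrow> 'o \<Rightarrow> 'm set" where
  "hom C A B = {f \<in> arr C. src C f = A \<and> trg C f = B}"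

locale category =
  fixes C :: "('o, 'm) cat"
  assumes src_obj: "f \<in> arr C \<Longrightarrow> src C f \<in> obj C"
    and trg_obj: "f \<in> arr C \<Longrightarrow> trg C f \<in> obj C"
    and idt_hom: "A \<in> obj C \<Longrightarrow> idt C A \<in> hom C A A"
    and cmp_hom: "f \<in> hom C A B \<Longrightarrow> g \<in> hom C B D \<Longrightarrow> cmp C f g \<in> hom C A D"
    and cmp_assoc: "f \<in> hom C A B \<Longrightarrow> g \<in> hom C B D \<Longrightarrow> h \<in> hom C D E \<Longrightarrow>
      cmp C (cmp C f g) h = cmp C f (cmp C g h)"
    and idt_left: "f \<in> hom C A B \<Longrightarrow> cmp C (idt C A) f = f"
    and idt_right: "f \<in> hom C A B \<Longrightarrow> cmp C f (idt C B) = f"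

locale is_functor = S: category C + T: category D
  for C :: "('o, 'm) cat" and D :: "('p, 'n) cat"
    and F\<^sub>o :: "'o \<Rightarrow> 'p" and F\<^sub>m :: "'m \<Rightarrow> 'n" +
  assumes functor_obj: "A \<in> obj C \<Longrightarrow> F\<^sub>o A \<in> obj D"
    and functor_hom: "f \<in> hom C A B \<Longrightarrow> F\<^sub>m f \<in> hom D (F\<^sub>o A) (F\<^sub>o B)"
    and functor_idt: "A \<in> obj C \<Longrightarrow> F\<^sub>m (idt C A) = idt D (F\<^sub>o A)"
    and functor_cmp: "f \<in> hom C A B \<Longrightarrow> g \<in> hom C B E \<Longrightarrow>
      F\<^sub>m (cmp C f g) = cmp D (F\<^sub>m f) (F\<^sub>m g)"

definition fully_faithful ::
  "('o, 'm) cat \<Rightarrow> ('p, 'n) cat \<Rightarrow> ('o \<Rightarrow> 'p) \<Rightarrow> ('m \<Rightarrow> 'n) \<Rightarrow> bool" where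
  "fully_faithful C D F\<^sub>o F\<^sub>m \<longleftrightarrow>
    (\<forall>A\<in>obj C. \<forall>B\<in>obj C. bij_betw F\<^sub>m (hom C A B) (hom D (F\<^sub>o A) (F\<^sub>o B)))"

text \<open>Functors enter only through their values on objects and arrows of the source, so the
  restriction of a functor to a subcategory is given by the same pair of maps.\<close>

definition cat_isomorphism ::
  "('o, 'm) cat \<Rightarrow> ('p, 'n) cat \<Rightarrow> ('o \<Rightarrow> 'p) \<Rightarrow> ('m \<Rightarrow> 'n) \<Rightarrow> bool" where
  "cat_isomorphism C D F\<^sub>o F\<^sub>m \<longleftrightarrow> is_functor C D F\<^sub>o F\<^sub>m \<and>
    (\<exists>G\<^sub>o G\<^sub>m. is_functor D C G\<^sub>o G\<^sub>m \<and>
      (\<forall>A\<in>obj C. G\<^sub>o (F\<^sub>o A) = A) \<and> (\<forall>f\<in>arr C. G\<^sub>m (F\<^sub>m f) = f) \<and>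
      (\<forall>B\<in>obj D. F\<^sub>o (G\<^sub>o B) = B) \<and> (\<forall>g\<in>arr D. F\<^sub>m (G\<^sub>m g) = g))"

definition full_sub :: "('o, 'm) cat \<Rightarrow> 'o set \<Rightarrow> ('o, 'm) cat" where
  "full_sub C S = C\<lparr>obj := S, arr := {f \<in> arr C. src C f \<in> S \<and> trg C f \<in> S}\<rparr>"

lemma category_full_sub:
  assumes "category C" and "S \<subseteq> obj C"
  shows "category (full_sub C S)"
proof -
  interpret category C by fact
  have hom: "f \<in> hom (full_sub C S) A B \<longleftrightarrow> f \<in> hom C A B \<and> A \<in> S \<and> B \<in> S" for f A B
    by (auto simp: hom_def full_sub_def)
  have eqs: "idt (full_sub C S) = idt C" "cmp (full_sub C S) = cmp C" "obj (full_sub C S) = S"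
    by (simp_all add: full_sub_def)
  show ?thesis
  proof
    fix f assume "f \<in> arr (full_sub C S)"
    then show "src (full_sub C S) f \<in> obj (full_sub C S)" "trg (full_sub C S) f \<in> obj (full_sub C S)"
      by (auto simp: full_sub_def)
  qed (use assms(2) in \<open>simp_all add: hom eqs, (blast intro: idt_hom cmp_hom cmp_assoc idt_left idt_right)+\<close>)
qed

section \<open>Categories of sets and maps\<close>

text \<open>An arrow is a triple of source, map and target; the map is extensional on the source
  (equal to \<open>undefined\<close> outside it), so that equality of arrows is equality of maps.\<close>

type_synonym 'b set_arr = "'b set \<times> ('b \<Rightarrow> 'b) \<times> 'b set"
type_synonym 'b set_cat = "('b set, 'b set_arr) cat"

definition map_arr :: "'b set \<Rightarrow> ('b \<Rightarrow> 'b) \<Rightarrow> 'b set \<Rightarrow> 'b set_arr" where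
  "map_arr A f B = (A, restrict f A, B)"

definition cmp_arr :: "'b set_arr \<Rightarrow> 'b set_arr \<Rightarrow> 'b set_arr" where
  "cmp_arr f g = (fst f, compose (fst f) (fst (snd g)) (fst (snd f)), snd (snd g))"

lemma cmp_arr_assoc:
  assumes "fst (snd f) \<in> fst f \<rightarrow> fst g"
  shows "cmp_arr (cmp_arr f g) h = cmp_arr f (cmp_arr g h)"
  using compose_assoc[OF assms] by (simp add: cmp_arr_def)

lemma cmp_arr_idt:
  assumes "fst (snd f) \<in> fst f \<rightarrow>\<^sub>E snd (snd f)"
  shows "cmp_arr (map_arr (fst f) (\<lambda>x. x) (fst f)) f = f"
    and "cmp_arr f (map_arr (snd (snd f)) (\<lambda>x. x) (snd (snd f))) = f"
  using assms compose_Id[of "fst (snd f)" "fst f" "snd (snd f)"]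
    Id_compose[of "fst (snd f)" "fst f" "snd (snd f)"]
  by (auto simp: cmp_arr_def map_arr_def prod_eq_iff PiE_def)

definition make_set_cat :: "'b set set \<Rightarrow> 'b set_arr set \<Rightarrow> 'b set_cat" where
  "make_set_cat Obj Arr = \<lparr>obj = Obj, arr = Arr, src = fst, trg = snd \<circ> snd,
    idt = (\<lambda>A. map_arr A (\<lambda>x. x) A), cmp = cmp_arr\<rparr>"

definition incl :: "'b set \<Rightarrow> 'b set \<Rightarrow> 'b set_arr" where
  "incl A B = map_arr A (\<lambda>x. x) B"

definition inclusion_preserving ::
  "'a set_cat \<Rightarrow> 'b set_cat \<Rightarrow> ('a set \<Rightarrow> 'b set) \<Rightarrow> ('a set_arr \<Rightarrow> 'b set_arr) \<Rightarrow> bool" where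
  "inclusion_preserving C D F\<^sub>o F\<^sub>m \<longleftrightarrow>
    (\<forall>A\<in>obj C. \<forall>B\<in>obj C. A \<subseteq> B \<longrightarrow>
      F\<^sub>o A \<subseteq> F\<^sub>o B \<and> F\<^sub>m (incl A B) = incl (F\<^sub>o A) (F\<^sub>o B))"

definition cat_ideal :: "'b set_cat \<Rightarrow> 'b set \<Rightarrow> 'b set_cat" where
  "cat_ideal C A = full_sub C {B \<in> obj C. B \<subseteq> A}"

definition local_isomorphism ::
  "'a set_cat \<Rightarrow> 'b set_cat \<Rightarrow> ('a set \<Rightarrow> 'b set) \<Rightarrow> ('a set_arr \<Rightarrow> 'b set_arr) \<Rightarrow> bool" where
  "local_isomorphism C D F\<^sub>o F\<^sub>m \<longleftrightarrow>
    is_functor C D F\<^sub>o F\<^sub>m \<and> inclusion_preserving C D F\<^sub>o F\<^sub>m \<and> fully_faithful C D F\<^sub>o F\<^sub>m \<and>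
    (\<forall>A\<in>obj C. cat_isomorphism (cat_ideal C A) (cat_ideal D (F\<^sub>o A)) F\<^sub>o F\<^sub>m)"

definition power_cat :: "'a set \<Rightarrow> 'a set_cat" where
  "power_cat X = make_set_cat {A. A \<subseteq> X \<and> A \<noteq> {}}
    {(A, f, B) | A f B. A \<subseteq> X \<and> A \<noteq> {} \<and> B \<subseteq> X \<and> B \<noteq> {} \<and> f \<in> A \<rightarrow>\<^sub>E B}"

lemma category_power_cat: "category (power_cat X)"
proof -
  have hom: "f \<in> hom (power_cat X) A B \<longleftrightarrow> A \<subseteq> X \<and> A \<noteq> {} \<and> B \<subseteq> X \<and> B \<noteq> {} \<and>
      fst f = A \<and> snd (snd f) = B \<and> fst (snd f) \<in> A \<rightarrow>\<^sub>E B" for f A B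
    by (cases f) (auto simp: power_cat_def make_set_cat_def hom_def)
  have eqs: "idt (power_cat X) = (\<lambda>A. map_arr A (\<lambda>x. x) A)" "cmp (power_cat X) = cmp_arr"
    "obj (power_cat X) = {A. A \<subseteq> X \<and> A \<noteq> {}}"
    by (simp_all add: power_cat_def make_set_cat_def)
  show ?thesis
  proof
    fix f assume "f \<in> arr (power_cat X)"
    then show "src (power_cat X) f \<in> obj (power_cat X)" "trg (power_cat X) f \<in> obj (power_cat X)"
      by (auto simp: power_cat_def make_set_cat_def)
  next
    fix f g A B D assume "f \<in> hom (power_cat X) A B" "g \<in> hom (power_cat X) B D"
    then show "cmp (power_cat X) f g \<in> hom (power_cat X) A D"
      unfolding hom eqs by (auto simp: cmp_arr_def compose_def)
  qed (unfold hom eqs, auto simp: cmp_arr_idt intro!: cmp_arr_assoc,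
      simp_all add: map_arr_def)
qed

section \<open>Transformations and partitions\<close>

definition transformations :: "'a set \<Rightarrow> ('a \<Rightarrow> 'a) set" where
  "transformations X = X \<rightarrow>\<^sub>E X"

text \<open>The rank is a cardinal, possibly infinite.\<close>

definition rank :: "'a set \<Rightarrow> ('a \<Rightarrow> 'a) \<Rightarrow> 'a rel" where
  "rank X \<theta> = |\<theta> ` X|"

definition fibres :: "'a set \<Rightarrow> ('a \<Rightarrow> 'a) \<Rightarrow> 'a set set" where
  "fibres X \<theta> = (\<lambda>y. {x \<in> X. \<theta> x = y}) ` (\<theta> ` X)"

definition saturates :: "'a set \<Rightarrow> 'a set set \<Rightarrow> bool" where
  "saturates A \<pi> \<longleftrightarrow> (\<forall>K\<in>\<pi>. \<exists>x. x \<in> A \<inter> K)"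

definition separates :: "'a set set \<Rightarrow> 'a set \<Rightarrow> bool" where
  "separates \<pi> A \<longleftrightarrow> (\<forall>K\<in>\<pi>. \<forall>x\<in>A \<inter> K. \<forall>y\<in>A \<inter> K. x = y)"

definition cross_section :: "'a set \<Rightarrow> 'a set set \<Rightarrow> bool" where
  "cross_section A \<pi> \<longleftrightarrow> (\<forall>K\<in>\<pi>. \<exists>!x. x \<in> A \<inter> K)"

section \<open>The categories associated with a transformation\<close>

definition P_cat :: "'a set \<Rightarrow> ('a \<Rightarrow> 'a) \<Rightarrow> 'a set_cat" where
  "P_cat X \<theta> = full_sub (power_cat X) {A \<in> obj (power_cat X). separates (fibres X \<theta>) A}"

definition bar :: "'a set \<Rightarrow> 'a set set \<Rightarrow> ('a set \<Rightarrow> 'a) set" where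
  "bar X \<pi> = \<pi> \<rightarrow>\<^sub>E X"

definition sat_partitions :: "'a set \<Rightarrow> ('a \<Rightarrow> 'a) \<Rightarrow> 'a set set set" where
  "sat_partitions X \<theta> = {\<pi>. partition_on X \<pi> \<and> saturates (\<theta> ` X) \<pi>}"

text \<open>A map \<open>\<eta>\<close> from \<open>\<pi>\<^sub>2\<close> to \<open>\<pi>\<^sub>1\<close> induces the map
  \<open>\<alpha> \<mapsto> \<eta>\<alpha>\<close> (first \<open>\<eta>\<close>, then \<open>\<alpha>\<close>).\<close>

definition star :: "'a set \<Rightarrow> 'a set set \<Rightarrow> 'a set set \<Rightarrow> ('a set \<Rightarrow> 'a set)
    \<Rightarrow> ('a set \<Rightarrow> 'a) set_arr" where
  "star X \<pi>\<^sub>1 \<pi>\<^sub>2 \<eta> = map_arr (bar X \<pi>\<^sub>1) (\<lambda>\<alpha>. compose \<pi>\<^sub>2 \<alpha> \<eta>) (bar X \<pi>\<^sub>2)"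

definition Pi_cat :: "'a set \<Rightarrow> ('a \<Rightarrow> 'a) \<Rightarrow> ('a set \<Rightarrow> 'a) set_cat" where
  "Pi_cat X \<theta> = make_set_cat (bar X ` sat_partitions X \<theta>)
    {star X \<pi>\<^sub>1 \<pi>\<^sub>2 \<eta> | \<pi>\<^sub>1 \<pi>\<^sub>2 \<eta>.
      \<pi>\<^sub>1 \<in> sat_partitions X \<theta> \<and> \<pi>\<^sub>2 \<in> sat_partitions X \<theta> \<and> \<eta> \<in> \<pi>\<^sub>2 \<rightarrow>\<^sub>E \<pi>\<^sub>1}"

text \<open>The normal dual \<open>N\<^sup>*\<Pi>\<^sub>\<theta>\<close> and its \<open>M\<close>-sets, under the
  identification of the normal dual with a category of subsets.\<close>

definition N_dual_cat :: "'a set \<Rightarrow> ('a \<Rightarrow> 'a) \<Rightarrow> 'a set_cat" where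
  "N_dual_cat X \<theta> = full_sub (power_cat X) {A \<in> obj (power_cat X). |A| \<le>o rank X \<theta>}"

definition M_set :: "'a set \<Rightarrow> ('a \<Rightarrow> 'a) \<Rightarrow> 'a set \<Rightarrow> ('a set \<Rightarrow> 'a) set set" where
  "M_set X \<theta> B = {bar X \<pi> | \<pi>. \<pi> \<in> sat_partitions X \<theta> \<and> cross_section B \<pi>}"

definition cross_connection ::
  "'a set \<Rightarrow> ('a \<Rightarrow> 'a) \<Rightarrow> ('a set \<Rightarrow> 'a set) \<Rightarrow> ('a set_arr \<Rightarrow> 'a set_arr) \<Rightarrow> bool" where
  "cross_connection X \<theta> F\<^sub>o F\<^sub>m \<longleftrightarrow>
    local_isomorphism (P_cat X \<theta>) (N_dual_cat X \<theta>) F\<^sub>o F\<^sub>m \<and>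
    (\<forall>P\<in>obj (Pi_cat X \<theta>). \<exists>A\<in>obj (P_cat X \<theta>). P \<in> M_set X \<theta> (F\<^sub>o A))"

definition Delta_obj :: "('a \<Rightarrow> 'a) \<Rightarrow> 'a set \<Rightarrow> 'a set" where
  "Delta_obj \<theta> A = \<theta> ` A"

definition Delta_arr :: "('a \<Rightarrow> 'a) \<Rightarrow> 'a set_arr \<Rightarrow> 'a set_arr" where
  "Delta_arr \<theta> f = (let A = fst f; B = snd (snd f) in
    cmp_arr (cmp_arr (map_arr (\<theta> ` A) (the_inv_into A \<theta>) A) f) (map_arr B \<theta> (\<theta> ` B)))"

section \<open>Well-definedness\<close>

lemma category_P_cat: "category (P_cat X \<theta>)"
  unfolding P_cat_def by (intro category_full_sub category_power_cat) auto

lemma category_N_dual_cat: "category (N_dual_cat X \<theta>)"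
  unfolding N_dual_cat_def by (intro category_full_sub category_power_cat) auto

lemma cmp_arr_star:
  assumes "\<eta> \<in> \<pi>\<^sub>2 \<rightarrow>\<^sub>E \<pi>\<^sub>1" and "\<zeta> \<in> \<pi>\<^sub>3 \<rightarrow>\<^sub>E \<pi>\<^sub>2"
  shows "cmp_arr (star X \<pi>\<^sub>1 \<pi>\<^sub>2 \<eta>) (star X \<pi>\<^sub>2 \<pi>\<^sub>3 \<zeta>) = star X \<pi>\<^sub>1 \<pi>\<^sub>3 (compose \<pi>\<^sub>3 \<eta> \<zeta>)"
proof -
  have "compose \<pi>\<^sub>2 \<alpha> \<eta> \<in> bar X \<pi>\<^sub>2" if "\<alpha> \<in> bar X \<pi>\<^sub>1" for \<alpha>
    using that assms by (auto simp: bar_def compose_def)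
  moreover have "compose \<pi>\<^sub>3 (compose \<pi>\<^sub>2 \<alpha> \<eta>) \<zeta> = compose \<pi>\<^sub>3 \<alpha> (compose \<pi>\<^sub>3 \<eta> \<zeta>)" for \<alpha>
    using compose_assoc[of \<zeta> \<pi>\<^sub>3 \<pi>\<^sub>2 \<alpha> \<eta>] assms by (simp add: PiE_def)
  ultimately show ?thesis
    by (auto simp: cmp_arr_def star_def map_arr_def compose_def[of "bar X \<pi>\<^sub>1"] intro!: restrict_ext)
qed

text \<open>A partition is determined by its set of maps to \<open>X\<close>, so the definitions of
  \<open>Pi_cat\<close> and \<open>M_set\<close> do not depend on the choice of \<open>\<pi>\<close>.\<close>

lemma inj_on_bar: "inj_on (bar X) {\<pi>. partition_on X \<pi>}"
proof (rule inj_onI, clarify)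
  fix \<pi> \<rho> assume p: "partition_on X \<pi>" and r: "partition_on X \<rho>" and eq: "bar X \<pi> = bar X \<rho>"
  show "\<pi> = \<rho>"
  proof (cases "\<exists>a\<in>X. a \<noteq> undefined")
    case True
    then obtain a where a: "a \<in> X" "a \<noteq> undefined" by blast
    have sub: "\<sigma> \<subseteq> \<tau>" if "bar X \<sigma> = bar X \<tau>" for \<sigma> \<tau> :: "'a set set"
    proof
      fix K assume K: "K \<in> \<sigma>"
      have "restrict (\<lambda>_. a) \<sigma> \<in> bar X \<sigma>" using a by (simp add: bar_def)
      then have "restrict (\<lambda>_. a) \<sigma> \<in> bar X \<tau>" by (simp only: that)
      then have *: "restrict (\<lambda>_. a) \<sigma> \<in> \<tau> \<rightarrow>\<^sub>E X" by (simp only: bar_def)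
      have "restrict (\<lambda>_. a) \<sigma> K = a" using K by simp
      then show "K \<in> \<tau>" using a PiE_arb[OF *, of K] by fastforce
    qed
    show ?thesis using sub[OF eq] sub[OF eq[symmetric]] by blast
  next
    case False
    then have X: "X \<subseteq> {undefined}" by auto
    have *: "\<sigma> = (if X = {} then {} else {X})" if "partition_on X \<sigma>" for \<sigma>
    proof -
      have u: "\<Union>\<sigma> = X" and ne: "{} \<notin> \<sigma>" using that by (auto simp: partition_on_def)
      have "K = X" if "K \<in> \<sigma>" for K
      proof -
        have "K \<subseteq> X" "K \<noteq> {}" using that u ne by auto
        then show ?thesis using X by blast
      qed
      then have "\<sigma> \<subseteq> {X}" by blast
      then show ?thesis using u ne by (auto simp: subset_singleton_iff)
    qed
    show ?thesis using *[OF p] *[OF r] by simp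
  qed
qed

lemma category_Pi_cat: "category (Pi_cat X \<theta>)"
proof -
  let ?S = "sat_partitions X \<theta>"
  have hom: "f \<in> hom (Pi_cat X \<theta>) A B \<longleftrightarrow> (\<exists>\<pi>\<^sub>1\<in>?S. \<exists>\<pi>\<^sub>2\<in>?S. \<exists>\<eta>\<in>\<pi>\<^sub>2 \<rightarrow>\<^sub>E \<pi>\<^sub>1.
      f = star X \<pi>\<^sub>1 \<pi>\<^sub>2 \<eta> \<and> A = bar X \<pi>\<^sub>1 \<and> B = bar X \<pi>\<^sub>2)" for f A B
  proof -
    have "fst (star X \<pi>\<^sub>1 \<pi>\<^sub>2 \<eta>) = bar X \<pi>\<^sub>1" "snd (snd (star X \<pi>\<^sub>1 \<pi>\<^sub>2 \<eta>)) = bar X \<pi>\<^sub>2"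
      for \<pi>\<^sub>1 \<pi>\<^sub>2 \<eta>
      by (simp_all add: star_def map_arr_def)
    then show ?thesis
      unfolding Pi_cat_def make_set_cat_def hom_def cat.simps o_apply mem_Collect_eq by metis
  qed
  have inj: "\<pi> = \<rho>" if "bar X \<pi> = bar X \<rho>" "\<pi> \<in> ?S" "\<rho> \<in> ?S" for \<pi> \<rho>
    using inj_onD[OF inj_on_bar that(1)] that(2,3) by (auto simp: sat_partitions_def)
  have cl: "compose \<pi>\<^sub>2 \<alpha> \<eta> \<in> bar X \<pi>\<^sub>2" if "\<alpha> \<in> bar X \<pi>\<^sub>1" "\<eta> \<in> \<pi>\<^sub>2 \<rightarrow>\<^sub>E \<pi>\<^sub>1" for \<alpha> \<eta> \<pi>\<^sub>1 \<pi>\<^sub>2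
    using that by (auto simp: bar_def compose_def)
  have obj: "obj (Pi_cat X \<theta>) = bar X ` ?S" and arr: "arr (Pi_cat X \<theta>) =
      {star X \<pi>\<^sub>1 \<pi>\<^sub>2 \<eta> | \<pi>\<^sub>1 \<pi>\<^sub>2 \<eta>. \<pi>\<^sub>1 \<in> ?S \<and> \<pi>\<^sub>2 \<in> ?S \<and> \<eta> \<in> \<pi>\<^sub>2 \<rightarrow>\<^sub>E \<pi>\<^sub>1}"
    and st: "src (Pi_cat X \<theta>) = fst" "trg (Pi_cat X \<theta>) = snd \<circ> snd"
    and cmp: "cmp (Pi_cat X \<theta>) = cmp_arr"
    and idt: "idt (Pi_cat X \<theta>) = (\<lambda>A. map_arr A (\<lambda>x. x) A)"
    by (simp_all add: Pi_cat_def make_set_cat_def)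
  have id: "map_arr (bar X \<pi>) (\<lambda>x. x) (bar X \<pi>) = star X \<pi> \<pi> (restrict (\<lambda>K. K) \<pi>)" for \<pi>
  proof -
    have "compose \<pi> \<alpha> (restrict (\<lambda>K. K) \<pi>) = \<alpha>" if "\<alpha> \<in> bar X \<pi>" for \<alpha>
      using that by (auto simp: bar_def compose_def fun_eq_iff PiE_iff extensional_def)
    then show ?thesis by (auto simp: star_def map_arr_def restrict_def fun_eq_iff)
  qed
  have c: "cmp (Pi_cat X \<theta>) f g \<in> hom (Pi_cat X \<theta>) A D"
    if "f \<in> hom (Pi_cat X \<theta>) A B" "g \<in> hom (Pi_cat X \<theta>) B D" for f g A B D
  proof -
    from that(1) obtain \<pi>\<^sub>1 \<pi>\<^sub>2 \<eta> where 1: "\<pi>\<^sub>1 \<in> ?S" "\<pi>\<^sub>2 \<in> ?S" "\<eta> \<in> \<pi>\<^sub>2 \<rightarrow>\<^sub>E \<pi>\<^sub>1"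
      "f = star X \<pi>\<^sub>1 \<pi>\<^sub>2 \<eta>" "A = bar X \<pi>\<^sub>1" "B = bar X \<pi>\<^sub>2" unfolding hom by blast
    from that(2) obtain \<rho>\<^sub>2 \<pi>\<^sub>3 \<zeta> where 2: "\<rho>\<^sub>2 \<in> ?S" "\<pi>\<^sub>3 \<in> ?S" "\<zeta> \<in> \<pi>\<^sub>3 \<rightarrow>\<^sub>E \<rho>\<^sub>2"
      "g = star X \<rho>\<^sub>2 \<pi>\<^sub>3 \<zeta>" "B = bar X \<rho>\<^sub>2" "D = bar X \<pi>\<^sub>3" unfolding hom by blast
    have [simp]: "\<rho>\<^sub>2 = \<pi>\<^sub>2" using inj 1 2 by metis
    have "compose \<pi>\<^sub>3 \<eta> \<zeta> \<in> \<pi>\<^sub>3 \<rightarrow>\<^sub>E \<pi>\<^sub>1" using 1 2 by (auto simp: compose_def)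
    then show ?thesis unfolding hom cmp using 1 2 cmp_arr_star[of \<eta> \<pi>\<^sub>2 \<pi>\<^sub>1 \<zeta> \<pi>\<^sub>3 X] by auto
  qed
  have sets: "\<exists>u. f = (A, u, B) \<and> u \<in> A \<rightarrow>\<^sub>E B" if "f \<in> hom (Pi_cat X \<theta>) A B" for f A B
    using that cl unfolding hom by (auto simp: star_def map_arr_def)
  show ?thesis
  proof
    fix f assume "f \<in> arr (Pi_cat X \<theta>)"
    then show "src (Pi_cat X \<theta>) f \<in> obj (Pi_cat X \<theta>)" "trg (Pi_cat X \<theta>) f \<in> obj (Pi_cat X \<theta>)"
      by (auto simp: arr st obj star_def map_arr_def)
  next
    fix A assume "A \<in> obj (Pi_cat X \<theta>)"
    then obtain \<pi> where "\<pi> \<in> ?S" "A = bar X \<pi>" by (auto simp: obj)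
    moreover have "restrict (\<lambda>K. K) \<pi> \<in> \<pi> \<rightarrow>\<^sub>E \<pi>" by auto
    ultimately show "idt (Pi_cat X \<theta>) A \<in> hom (Pi_cat X \<theta>) A A"
      unfolding hom idt using id by blast
  next
    fix f g h A B D E
    assume "f \<in> hom (Pi_cat X \<theta>) A B" "g \<in> hom (Pi_cat X \<theta>) B D" "h \<in> hom (Pi_cat X \<theta>) D E"
    then show "cmp (Pi_cat X \<theta>) (cmp (Pi_cat X \<theta>) f g) h
        = cmp (Pi_cat X \<theta>) f (cmp (Pi_cat X \<theta>) g h)"
      by (fastforce dest!: sets simp: cmp intro!: cmp_arr_assoc)
  next
    fix f A B assume "f \<in> hom (Pi_cat X \<theta>) A B"
    then show "cmp (Pi_cat X \<theta>) (idt (Pi_cat X \<theta>) A) f = f"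
      and "cmp (Pi_cat X \<theta>) f (idt (Pi_cat X \<theta>) B) = f"
      using sets[of f A B] cmp_arr_idt[of f] by (auto simp: cmp idt)
  qed (use c in blast)
qed

end

(* A set separated by the fibre partition of \<theta> is one on which \<theta> is injective, so \<theta>
   carries each such A bijectively onto A\<theta>, and \<Delta> is conjugation by these bijections. This
   makes it a fully faithful functor compatible with inclusions. A fully faithful functor that is
   bijective on objects is an isomorphism, which settles the ideals, since B \<mapsto> B\<theta> is a
   bijection from the subsets of A onto those of A\<theta>. Finally, if Im \<theta> saturates \<pi>, choose for
   each class K of \<pi> a point of X mapped into K; the chosen points form a set A separated by the
   fibre partition whose image is a cross-section of \<pi>. *)
theory Submission
  imports Defs
begin

section \<open>Fully faithful functors and full subcategories\<close>

lemma homD: "f \<in> hom C A B \<Longrightarrow> f \<in> arr C" "f \<in> hom C A B \<Longrightarrow> src C f = A"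
  "f \<in> hom C A B \<Longrightarrow> trg C f = B"
  by (simp_all add: hom_def)

lemma arr_hom: "f \<in> arr C \<Longrightarrow> f \<in> hom C (src C f) (trg C f)"
  by (simp add: hom_def)

lemma (in category) hom_obj:
  assumes "f \<in> hom C A B"
  shows "A \<in> obj C" and "B \<in> obj C"
  using assms src_obj trg_obj by (auto simp: hom_def)

lemma full_sub_simps:
  "obj (full_sub C S) = S" "src (full_sub C S) = src C" "trg (full_sub C S) = trg C"
  "idt (full_sub C S) = idt C" "cmp (full_sub C S) = cmp C"
  by (simp_all add: full_sub_def)

lemma hom_full_sub: "hom (full_sub C S) A B = (if A \<in> S \<and> B \<in> S then hom C A B else {})"
  by (auto simp: hom_def full_sub_def)

lemma is_functor_full_sub:
  assumes "is_functor C D Fo Fm" and "S \<subseteq> obj C" and "T \<subseteq> obj D" and "Fo ` S \<subseteq> T"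
  shows "is_functor (full_sub C S) (full_sub D T) Fo Fm"
proof -
  interpret is_functor C D Fo Fm by fact
  interpret S': category "full_sub C S" by (rule category_full_sub[OF S.category_axioms assms(2)])
  interpret T': category "full_sub D T" by (rule category_full_sub[OF T.category_axioms assms(3)])
  show ?thesis
    using assms(2,4)
    by unfold_locales
      (auto simp: full_sub_simps hom_full_sub functor_hom functor_idt functor_cmp split: if_splits)
qed

text \<open>Fullness keeps the hom-sets between retained objects unchanged on both sides, so the
  bijections are inherited.\<close>

lemma fully_faithful_full_sub:
  assumes "fully_faithful C D Fo Fm" and "S \<subseteq> obj C" and "Fo ` S \<subseteq> T"
  shows "fully_faithful (full_sub C S) (full_sub D T) Fo Fm"
  using assms unfolding fully_faithful_def full_sub_simps hom_full_sub
  by (auto simp: image_subset_iff subset_iff)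

text \<open>Inverting \<open>Fo\<close> on objects and \<open>Fm\<close> on each hom-set gives the
  inverse functor. Its laws compare two parallel arrows of \<open>C\<close> with the same image
  under \<open>Fm\<close>, so they follow from faithfulness.\<close>

lemma cat_isomorphism_if_bij_objects:
  assumes "is_functor C D Fo Fm" and ff: "fully_faithful C D Fo Fm"
    and bij: "bij_betw Fo (obj C) (obj D)"
  shows "cat_isomorphism C D Fo Fm"
proof -
  interpret is_functor C D Fo Fm by fact
  define Go where "Go = the_inv_into (obj C) Fo"
  \<comment> \<open>Full faithfulness inverts \<open>Fm\<close> one hom-set at a time, so the
    hom-set in which the preimage is sought is read off from the source and target of
    \<open>g\<close>.\<close>
  define Gm where "Gm g = the_inv_into (hom C (Go (src D g)) (Go (trg D g))) Fm g" for g
  have Go_obj: "Go B \<in> obj C" and FG: "Fo (Go B) = B" if "B \<in> obj D" for B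
    using bij that the_inv_into_into[of Fo "obj C" B "obj C"] f_the_inv_into_f[of Fo "obj C" B]
    by (auto simp: Go_def bij_betw_def)
  have GF: "Go (Fo A) = A" if "A \<in> obj C" for A
    using bij that by (simp add: Go_def bij_betw_def the_inv_into_f_f)
  have bij_hom: "bij_betw Fm (hom C (Go A) (Go B)) (hom D A B)" if "A \<in> obj D" "B \<in> obj D" for A B
    using ff Go_obj[OF that(1)] Go_obj[OF that(2)] FG that by (metis fully_faithful_def)
  have Gm_hom: "Gm g \<in> hom C (Go A) (Go B)" and FGm: "Fm (Gm g) = g" if g: "g \<in> hom D A B" for g A B
  proof -
    note b = bij_hom[OF T.hom_obj[OF g]]
    show "Gm g \<in> hom C (Go A) (Go B)"
      using b g homD[OF g] the_inv_into_into[of Fm "hom C (Go A) (Go B)" g "hom C (Go A) (Go B)"]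
      by (simp add: Gm_def bij_betw_def)
    show "Fm (Gm g) = g"
      using b g homD[OF g] f_the_inv_into_f[of Fm "hom C (Go A) (Go B)" g]
      by (simp add: Gm_def bij_betw_def)
  qed
  have faithful: "f = f'" if "f \<in> hom C A B" "f' \<in> hom C A B" "Fm f = Fm f'" for f f' A B
    using ff S.hom_obj[OF that(1)] that by (auto simp: fully_faithful_def bij_betw_def dest: inj_onD)
  have "is_functor D C Go Gm"
  proof
    fix A assume A: "A \<in> obj D"
    have "Gm (idt D A) \<in> hom C (Go A) (Go A)" "idt C (Go A) \<in> hom C (Go A) (Go A)"
      using A Gm_hom T.idt_hom S.idt_hom Go_obj by blast+
    moreover have "Fm (Gm (idt D A)) = Fm (idt C (Go A))"
      using A FGm[OF T.idt_hom] functor_idt Go_obj FG by simp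
    ultimately show "Gm (idt D A) = idt C (Go A)" by (rule faithful)
  next
    fix f g A B E assume f: "f \<in> hom D A B" and g: "g \<in> hom D B E"
    have "Gm (cmp D f g) \<in> hom C (Go A) (Go E)" "cmp C (Gm f) (Gm g) \<in> hom C (Go A) (Go E)"
      using Gm_hom[OF T.cmp_hom[OF f g]] S.cmp_hom[OF Gm_hom[OF f] Gm_hom[OF g]] .
    moreover have "Fm (Gm (cmp D f g)) = Fm (cmp C (Gm f) (Gm g))"
      using FGm[OF T.cmp_hom[OF f g]] functor_cmp[OF Gm_hom[OF f] Gm_hom[OF g]]
        FGm[OF f] FGm[OF g] by simp
    ultimately show "Gm (cmp D f g) = cmp C (Gm f) (Gm g)" by (rule faithful)
  qed (use Go_obj Gm_hom in blast)+
  moreover have "Gm (Fm f) = f" if "f \<in> arr C" for f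
  proof -
    let ?A = "src C f" and ?B = "trg C f"
    have f: "f \<in> hom C ?A ?B" using that by (rule arr_hom)
    \<comment> \<open>\<open>Go\<close> inverts \<open>Fo\<close> at source and target, so
      \<open>Gm (Fm f)\<close> is parallel to \<open>f\<close> and faithfulness applies.\<close>
    have "Gm (Fm f) \<in> hom C ?A ?B"
      using Gm_hom[OF functor_hom[OF f]] GF S.hom_obj[OF f] by simp
    then show ?thesis using faithful f FGm[OF functor_hom[OF f]] by blast
  qed
  moreover have "Fm (Gm g) = g" if "g \<in> arr D" for g
    using FGm arr_hom[OF that] by blast
  ultimately show ?thesis
    unfolding cat_isomorphism_def using assms(1) GF FG by blast
qed

section \<open>Conjugation by \<open>\<theta>\<close>\<close>

text \<open>The inclusion of \<open>A\<close> in \<open>X\<close> puts any two elements of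
  \<open>A\<close> with the same value under \<theta> into a common fibre.\<close>

lemma separates_fibres_iff:
  assumes "A \<subseteq> X"
  shows "separates (fibres X \<theta>) A \<longleftrightarrow> inj_on \<theta> A"
  using assms unfolding separates_def fibres_def inj_on_def by auto

section \<open>Objects and hom-sets of the subset categories\<close>

lemma obj_power_cat: "obj (power_cat X) = {A. A \<subseteq> X \<and> A \<noteq> {}}"
  by (simp add: power_cat_def make_set_cat_def)

lemma hom_power_cat:
  assumes "A \<in> obj (power_cat X)" and "B \<in> obj (power_cat X)"
  shows "hom (power_cat X) A B = {(A, u, B) | u. u \<in> A \<rightarrow>\<^sub>E B}"
  using assms by (auto simp: power_cat_def make_set_cat_def hom_def)

lemma obj_P_cat: "obj (P_cat X \<theta>) = {A. A \<subseteq> X \<and> A \<noteq> {} \<and> inj_on \<theta> A}"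
  by (auto simp: P_cat_def full_sub_simps obj_power_cat separates_fibres_iff)

lemma obj_N_dual_cat:
  "obj (N_dual_cat X \<theta>) = {A. A \<subseteq> X \<and> A \<noteq> {} \<and> |A| \<le>o rank X \<theta>}"
  by (auto simp: N_dual_cat_def full_sub_simps obj_power_cat)

lemma hom_P_cat:
  assumes "A \<in> obj (P_cat X \<theta>)" and "B \<in> obj (P_cat X \<theta>)"
  shows "hom (P_cat X \<theta>) A B = {(A, u, B) | u. u \<in> A \<rightarrow>\<^sub>E B}"
  using assms unfolding P_cat_def full_sub_simps hom_full_sub by (simp add: hom_power_cat)

lemma hom_N_dual_cat:
  assumes "A \<in> obj (N_dual_cat X \<theta>)" and "B \<in> obj (N_dual_cat X \<theta>)"
  shows "hom (N_dual_cat X \<theta>) A B = {(A, u, B) | u. u \<in> A \<rightarrow>\<^sub>E B}"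
  using assms unfolding N_dual_cat_def full_sub_simps hom_full_sub by (simp add: hom_power_cat)

lemma idt_cmp_cats:
  "idt (P_cat X \<theta>) A = map_arr A (\<lambda>x. x) A" "cmp (P_cat X \<theta>) = cmp_arr"
  "idt (N_dual_cat X \<theta>) A = map_arr A (\<lambda>x. x) A" "cmp (N_dual_cat X \<theta>) = cmp_arr"
  by (simp_all add: P_cat_def N_dual_cat_def full_sub_simps power_cat_def make_set_cat_def)

section \<open>The functor on arrows, its functoriality and full faithfulness\<close>

lemma Delta_arr_eq:
  assumes "inj_on \<theta> A" and "u \<in> A \<rightarrow> B"
  shows "Delta_arr \<theta> (A, u, B) = (\<theta> ` A, \<lambda>y\<in>\<theta> ` A. \<theta> (u (the_inv_into A \<theta> y)), \<theta> ` B)"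
  using assms by (auto simp: Delta_arr_def Let_def cmp_arr_def map_arr_def compose_def
      the_inv_into_f_f fun_eq_iff Pi_iff)

text \<open>The inverse of \<theta> on \<open>A\<close> cancels against \<theta>. The case
  \<open>A = B\<close> handles identities, the general case inclusions.\<close>

lemma Delta_arr_map_arr_id:
  assumes "inj_on \<theta> A" and "A \<subseteq> B"
  shows "Delta_arr \<theta> (map_arr A (\<lambda>x. x) B) = map_arr (\<theta> ` A) (\<lambda>x. x) (\<theta> ` B)"
  using assms unfolding map_arr_def
  by (subst Delta_arr_eq) (auto simp: fun_eq_iff the_inv_into_f_f)

text \<open>The image of \<open>A\<close> lies in the image of \<open>X\<close>, so its cardinality
  is at most the rank, finite or not.\<close>

lemma Delta_obj_in_N_dual:
  assumes "\<theta> \<in> transformations X" and "A \<in> obj (P_cat X \<theta>)"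
  shows "\<theta> ` A \<in> obj (N_dual_cat X \<theta>)"
  using assms card_of_mono1[of "\<theta> ` A" "\<theta> ` X"]
  by (auto simp: obj_P_cat obj_N_dual_cat rank_def transformations_def)

lemma is_functor_Delta:
  assumes "\<theta> \<in> transformations X"
  shows "is_functor (P_cat X \<theta>) (N_dual_cat X \<theta>) (Delta_obj \<theta>) (Delta_arr \<theta>)"
proof -
  interpret P: category "P_cat X \<theta>" by (rule category_P_cat)
  interpret N: category "N_dual_cat X \<theta>" by (rule category_N_dual_cat)
  note objI = Delta_obj_in_N_dual[OF assms]
  show ?thesis
  proof
    show "Delta_obj \<theta> A \<in> obj (N_dual_cat X \<theta>)" if "A \<in> obj (P_cat X \<theta>)" for A
      using objI that by (simp add: Delta_obj_def)
    show "Delta_arr \<theta> (idt (P_cat X \<theta>) A) = idt (N_dual_cat X \<theta>) (Delta_obj \<theta> A)"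
      if "A \<in> obj (P_cat X \<theta>)" for A
      using that by (simp add: Delta_arr_map_arr_id obj_P_cat idt_cmp_cats Delta_obj_def)
  next
    fix f A B assume f: "f \<in> hom (P_cat X \<theta>) A B"
    note AB = P.hom_obj[OF f]
    from f AB obtain u where u: "f = (A, u, B)" "u \<in> A \<rightarrow>\<^sub>E B" by (auto simp: hom_P_cat)
    have inj: "inj_on \<theta> A" using AB by (simp add: obj_P_cat)
    have "\<theta> (u (the_inv_into A \<theta> y)) \<in> \<theta> ` B" if "y \<in> \<theta> ` A" for y
      using that u inj by (auto simp: the_inv_into_f_f)
    then show "Delta_arr \<theta> f \<in> hom (N_dual_cat X \<theta>) (Delta_obj \<theta> A) (Delta_obj \<theta> B)"
      using u inj AB objI by (auto simp: Delta_arr_eq Delta_obj_def hom_N_dual_cat PiE_def)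
  next
    fix f g A B E assume f: "f \<in> hom (P_cat X \<theta>) A B" and g: "g \<in> hom (P_cat X \<theta>) B E"
    note obs = P.hom_obj[OF f] P.hom_obj[OF g]
    from f g obs obtain u v where u: "f = (A, u, B)" "u \<in> A \<rightarrow> B" and v: "g = (B, v, E)" "v \<in> B \<rightarrow> E"
      by (auto simp: hom_P_cat PiE_def)
    have inj: "inj_on \<theta> A" "inj_on \<theta> B" using obs by (simp_all add: obj_P_cat)
    have "compose A v u \<in> A \<rightarrow> E" using u v by (auto simp: compose_def)
    moreover have "cmp_arr f g = (A, compose A v u, E)" using u v by (simp add: cmp_arr_def)
    \<comment> \<open>In the composite of the two conjugates, \<theta> followed by its inverse on
      \<open>B\<close> cancels at the values of \<open>u\<close>, leaving the conjugate of the
      composite.\<close>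
    ultimately show "Delta_arr \<theta> (cmp (P_cat X \<theta>) f g)
        = cmp (N_dual_cat X \<theta>) (Delta_arr \<theta> f) (Delta_arr \<theta> g)"
      using u v inj
      by (auto simp: idt_cmp_cats Delta_arr_eq cmp_arr_def compose_def fun_eq_iff
          the_inv_into_f_f Pi_iff)
  qed
qed

lemma inclusion_preserving_Delta:
  "inclusion_preserving (P_cat X \<theta>) (N_dual_cat X \<theta>) (Delta_obj \<theta>) (Delta_arr \<theta>)"
  by (auto simp: inclusion_preserving_def incl_def Delta_obj_def obj_P_cat Delta_arr_map_arr_id)

lemma fully_faithful_Delta:
  assumes "\<theta> \<in> transformations X"
  shows "fully_faithful (P_cat X \<theta>) (N_dual_cat X \<theta>) (Delta_obj \<theta>) (Delta_arr \<theta>)"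
  unfolding fully_faithful_def
proof (intro ballI)
  fix A B assume A: "A \<in> obj (P_cat X \<theta>)" and B: "B \<in> obj (P_cat X \<theta>)"
  have inj: "inj_on \<theta> A" "inj_on \<theta> B" using A B by (simp_all add: obj_P_cat)
  have homs: "hom (P_cat X \<theta>) A B = {(A, u, B) | u. u \<in> A \<rightarrow>\<^sub>E B}"
    "hom (N_dual_cat X \<theta>) (\<theta> ` A) (\<theta> ` B) = {(\<theta> ` A, v, \<theta> ` B) | v. v \<in> \<theta> ` A \<rightarrow>\<^sub>E \<theta> ` B}"
    using A B Delta_obj_in_N_dual[OF assms] by (simp_all add: hom_P_cat hom_N_dual_cat)
  have "inj_on (Delta_arr \<theta>) (hom (P_cat X \<theta>) A B)"
  proof (rule inj_onI)
    fix f g assume "f \<in> hom (P_cat X \<theta>) A B" "g \<in> hom (P_cat X \<theta>) A B"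
      and eq: "Delta_arr \<theta> f = Delta_arr \<theta> g"
    then obtain u v where u: "f = (A, u, B)" "u \<in> A \<rightarrow>\<^sub>E B" and v: "g = (A, v, B)" "v \<in> A \<rightarrow>\<^sub>E B"
      by (auto simp: homs)
    have "u x = v x" if x: "x \<in> A" for x
    proof -
      \<comment> \<open>Both conjugates are evaluated at \<open>\<theta> x\<close>, where the
        inverse on \<open>A\<close> returns \<open>x\<close>; injectivity on \<open>B\<close> then
        removes the outer \<theta>.\<close>
      have "\<theta> (u x) = \<theta> (v x)"
        using eq x u v inj(1) fun_cong[of _ _ "\<theta> x"]
        by (fastforce simp: Delta_arr_eq PiE_def the_inv_into_f_f)
      then show ?thesis using inj(2) u v x by (auto dest: inj_onD)
    qed
    \<comment> \<open>Arrows carry extensional maps, so agreement on \<open>A\<close> is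
      equality.\<close>
    then show "f = g" using u v by (auto intro: PiE_ext)
  qed
  moreover have "Delta_arr \<theta> ` hom (P_cat X \<theta>) A B = hom (N_dual_cat X \<theta>) (\<theta> ` A) (\<theta> ` B)"
  proof (intro equalityI subsetI)
    fix g assume "g \<in> Delta_arr \<theta> ` hom (P_cat X \<theta>) A B"
    then show "g \<in> hom (N_dual_cat X \<theta>) (\<theta> ` A) (\<theta> ` B)"
      using is_functor.functor_hom[OF is_functor_Delta[OF assms]] by (auto simp: Delta_obj_def)
  next
    fix g assume "g \<in> hom (N_dual_cat X \<theta>) (\<theta> ` A) (\<theta> ` B)"
    then obtain v where v: "g = (\<theta> ` A, v, \<theta> ` B)" "v \<in> \<theta> ` A \<rightarrow>\<^sub>E \<theta> ` B" by (auto simp: homs)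
    \<comment> \<open>The preimage is the reverse conjugate: \<theta> on \<open>A\<close>, then
      \<open>v\<close>, then the inverse of \<theta> on \<open>B\<close>. Restriction to
      \<open>A\<close> makes it extensional.\<close>
    define u where "u = (\<lambda>x\<in>A. the_inv_into B \<theta> (v (\<theta> x)))"
    have u: "u x \<in> B" "\<theta> (u x) = v (\<theta> x)" if "x \<in> A" for x
    proof -
      have "v (\<theta> x) \<in> \<theta> ` B" using v that by blast
      then show "u x \<in> B" "\<theta> (u x) = v (\<theta> x)"
        using inj(2) that by (auto simp: u_def the_inv_into_f_f)
    qed
    have uE: "u \<in> A \<rightarrow>\<^sub>E B" using u(1) by (auto simp: u_def)
    have "Delta_arr \<theta> (A, u, B) = g"
      using uE u(2) v inj(1)
      by (auto simp: Delta_arr_eq PiE_iff extensional_def fun_eq_iff the_inv_into_f_f)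
    then show "g \<in> Delta_arr \<theta> ` hom (P_cat X \<theta>) A B" using uE by (force simp: homs)
  qed
  ultimately show "bij_betw (Delta_arr \<theta>) (hom (P_cat X \<theta>) A B)
      (hom (N_dual_cat X \<theta>) (Delta_obj \<theta> A) (Delta_obj \<theta> B))"
    by (simp add: bij_betw_def Delta_obj_def)
qed

section \<open>Isomorphisms of ideals\<close>

lemma bij_betw_Delta_obj_ideal:
  assumes "\<theta> \<in> transformations X" and "A \<in> obj (P_cat X \<theta>)"
  shows "bij_betw (Delta_obj \<theta>) {B \<in> obj (P_cat X \<theta>). B \<subseteq> A}
    {B \<in> obj (N_dual_cat X \<theta>). B \<subseteq> Delta_obj \<theta> A}"
proof -
  have inj: "inj_on \<theta> A" using assms(2) by (simp add: obj_P_cat)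
  \<comment> \<open>Injectivity passes to subsets, so the ideal of \<open>A\<close> contains every
    nonempty subset of \<open>A\<close>.\<close>
  have P: "B \<in> obj (P_cat X \<theta>)" if "B \<subseteq> A" "B \<noteq> {}" for B
    using that assms(2) inj by (auto simp: obj_P_cat intro: inj_on_subset)
  have "inj_on ((`) \<theta>) {B \<in> obj (P_cat X \<theta>). B \<subseteq> A}"
    by (rule inj_on_subset[OF inj_on_image_Pow[OF inj]]) auto
  moreover have "C \<in> (`) \<theta> ` {B \<in> obj (P_cat X \<theta>). B \<subseteq> A}"
    if "C \<in> obj (N_dual_cat X \<theta>)" "C \<subseteq> \<theta> ` A" for C
  proof -
    obtain B where "B \<subseteq> A" "C = \<theta> ` B" using \<open>C \<subseteq> \<theta> ` A\<close> by (auto simp: subset_image_iff)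
    \<comment> \<open>Objects are nonempty sets, and \<open>C\<close> is the image of
      \<open>B\<close>.\<close>
    moreover have "B \<noteq> {}" using that(1) calculation by (auto simp: obj_N_dual_cat)
    ultimately show ?thesis using P by blast
  qed
  ultimately show ?thesis
    using Delta_obj_in_N_dual[OF assms(1)] by (auto simp: bij_betw_def Delta_obj_def[abs_def])
qed

lemma local_isomorphism_Delta:
  assumes "\<theta> \<in> transformations X"
  shows "local_isomorphism (P_cat X \<theta>) (N_dual_cat X \<theta>) (Delta_obj \<theta>) (Delta_arr \<theta>)"
proof -
  note F = is_functor_Delta[OF assms] and ff = fully_faithful_Delta[OF assms]
  have "cat_isomorphism (cat_ideal (P_cat X \<theta>) A) (cat_ideal (N_dual_cat X \<theta>) (Delta_obj \<theta> A))
      (Delta_obj \<theta>) (Delta_arr \<theta>)" if "A \<in> obj (P_cat X \<theta>)" for A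
  proof -
    note bij = bij_betw_Delta_obj_ideal[OF assms that]
    \<comment> \<open>The bijection on objects also supplies the side condition that one ideal is
      mapped into the other.\<close>
    show ?thesis
      unfolding cat_ideal_def
      by (intro cat_isomorphism_if_bij_objects is_functor_full_sub[OF F]
          fully_faithful_full_sub[OF ff])
        (use bij in \<open>auto simp: full_sub_simps bij_betw_def\<close>)
  qed
  then show ?thesis
    using F ff inclusion_preserving_Delta by (simp add: local_isomorphism_def)
qed

section \<open>Cross-sections of saturated partitions\<close>

lemma exists_cross_section_image:
  assumes "partition_on X \<pi>" and "saturates (\<theta> ` X) \<pi>" and "X \<noteq> {}"
  obtains A where "A \<subseteq> X" and "A \<noteq> {}" and "inj_on \<theta> A" and "cross_section (\<theta> ` A) \<pi>"
proof -
  have "\<forall>K\<in>\<pi>. \<exists>x. x \<in> X \<and> \<theta> x \<in> K" using assms(2) by (auto simp: saturates_def)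
  then obtain s where s: "s K \<in> X" "\<theta> (s K) \<in> K" if "K \<in> \<pi>" for K by metis
  \<comment> \<open>The point chosen for \<open>K\<close> maps into \<open>K\<close>, so a class
    \<open>L\<close> containing its value meets \<open>K\<close> and equals it. This gives both
    injectivity on the chosen points and uniqueness in the cross-section.\<close>
  have disj: "K = L" if "\<theta> (s K) \<in> L" "K \<in> \<pi>" "L \<in> \<pi>" for K L
    using partition_onD2[OF assms(1)] s that by (auto dest: disjointD)
  show thesis
  proof
    show "s ` \<pi> \<subseteq> X" using s by blast
    show "inj_on \<theta> (s ` \<pi>)" using s disj by (force intro!: inj_onI)
    show "cross_section (\<theta> ` s ` \<pi>) \<pi>"
      unfolding cross_section_def using s disj by blast
    \<comment> \<open>The classes cover the nonempty set \<open>X\<close>, so there is at least one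
      class.\<close>
    show "s ` \<pi> \<noteq> {}" using partition_onD1[OF assms(1)] assms(3) by auto
  qed
qed

theorem proposition4p1:
  fixes X :: "'a set" and \<theta> :: "'a \<Rightarrow> 'a"
  assumes "X \<noteq> {}" and "\<theta> \<in> transformations X"
  shows "is_functor (P_cat X \<theta>) (N_dual_cat X \<theta>) (Delta_obj \<theta>) (Delta_arr \<theta>)
    \<and> cross_connection X \<theta> (Delta_obj \<theta>) (Delta_arr \<theta>)"
proof -
  have "\<exists>A\<in>obj (P_cat X \<theta>). P \<in> M_set X \<theta> (Delta_obj \<theta> A)" if "P \<in> obj (Pi_cat X \<theta>)" for P
  proof -
    from that obtain \<pi> where \<pi>: "P = bar X \<pi>" "\<pi> \<in> sat_partitions X \<theta>"
      by (auto simp: Pi_cat_def make_set_cat_def)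
    then have part: "partition_on X \<pi>" and sat: "saturates (\<theta> ` X) \<pi>"
      by (auto simp: sat_partitions_def)
    obtain A where A: "A \<subseteq> X" "A \<noteq> {}" "inj_on \<theta> A" "cross_section (\<theta> ` A) \<pi>"
      by (rule exists_cross_section_image[OF part sat assms(1)])
    then have "A \<in> obj (P_cat X \<theta>)" by (simp add: obj_P_cat)
    \<comment> \<open>The partition representing \<open>P\<close> is itself the witness: it is
      saturated by the image of \<theta> and has the image of \<open>A\<close> as a
      cross-section.\<close>
    moreover have "P \<in> M_set X \<theta> (Delta_obj \<theta> A)"
      using \<pi> A(4) by (auto simp: M_set_def Delta_obj_def)
    ultimately show ?thesis by blast
  qed
  then show ?thesis
    using is_functor_Delta[OF assms(2)] local_isomorphism_Delta[OF assms(2)]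
    by (simp add: cross_connection_def)
qed

end
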